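(* Let $A\in\mathbb{R}^{m\times n}$ and let $h:\mathbb{R}^m\to\mathbb{R}_+$ be a continuous convex function. Let $(\bar b,\bar\lambda)\in\mathbb{R}^m\times\mathbb{R}_{++}$. Suppose that there is $\bar x\in S(\bar b,\bar\lambda)$ such that $h$ is twice continuously differentiable around $A\bar x-\bar b$ and $$\ker(\nabla^2h(A\bar x-\bar b))\cap \mathrm{rge}(A_{J_h})=\{0\},\qquad J_h:=\{i\in[n]: |A_i^T\nabla h(A\bar x-\bar b)|=\bar\lambda\}.$$ Then the mapping $H(b,\lambda):=\{Ax: x\in S(b,\lambda)\}$ is single-valued and Lipschitz continuous in a neighborhood of $(\bar b,\bar\lambda)$.
   Context: $\mathbb{R}_+=[0,\infty)$, $\mathbb{R}_{++}=(0,\infty)$, $[n]=\{1,\dots,n\}$; $\|\cdot\|$ is the Euclidean norm and $\|\cdot\|_1$ the $\ell_1$-norm. For $(b,\lambda)\in\mathbb{R}^m\times\mathbb{R}_+$, $S(b,\lambda):=\mathrm{argmin}_{x\in\mathbb{R}^n}\{h(Ax-b)+\lambda\|x\|_1\}$, a set-valued mapping of $(b,\lambda)$. $A_i$ is the $i$-th column of $A$; for $I\subset[n]$, $A_I$ is the submatrix of columns of $A$ indexed by $I$, and $\mathrm{rge}(A_I)$ is its range ($\{0\}$ if $I=\emptyset$). Single-valued means that the value is a singleton. *)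

theory Defs
  imports "HOL-Analysis.Analysis"
begin

definition gradient :: "('a::euclidean_space \<Rightarrow> real) \<Rightarrow> 'a \<Rightarrow> 'a"
  where "gradient f x = (THE D. GDERIV f x :> D)"

lemma gradient_eqI:
  assumes "GDERIV f x :> D"
  shows "gradient f x = D"
  unfolding gradient_def
proof (rule the_equality)
  show "GDERIV f x :> D" by (fact assms)
next
  fix E assume "GDERIV f x :> E"
  with assms have "(\<lambda>h. inner h E) = (\<lambda>h. inner h D)"
    unfolding gderiv_def by (rule has_derivative_unique[rotated])
  then show "E = D"
    by (metis vector_eq_rdot inner_commute)
qed

lemma GDERIV_gradient:
  assumes "f differentiable (at x)"
  shows "GDERIV f x :> gradient f x"
proof -
  obtain f' where f': "(f has_derivative f') (at x)"
    using assms unfolding differentiable_def by blast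
  then have "linear f'"
    by (rule has_derivative_linear)
  then have "f' = (\<lambda>h. inner h (adjoint f' 1))"
    using adjoint_works[of f' _ 1] by (auto simp: fun_eq_iff)
  with f' have "GDERIV f x :> adjoint f' 1"
    unfolding gderiv_def by simp
  with gradient_eqI show ?thesis by metis
qed

definition hessian :: "(real^'m \<Rightarrow> real) \<Rightarrow> real^'m \<Rightarrow> real^'m^'m"
  where "hessian f x = jacobian (gradient f) (at x)"

definition twice_continuously_differentiable_around :: "(real^'m \<Rightarrow> real) \<Rightarrow> real^'m \<Rightarrow> bool"
  where "twice_continuously_differentiable_around f z \<longleftrightarrow>
    (\<exists>U. open U \<and> z \<in> U \<and>
      (\<forall>y\<in>U. f differentiable (at y)) \<and>
      (\<forall>y\<in>U. gradient f differentiable (at y)) \<and>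
      continuous_on U (hessian f))"

definition l1_norm :: "real^'n \<Rightarrow> real"
  where "l1_norm x = (\<Sum>i\<in>UNIV. \<bar>x $ i\<bar>)"

definition mat_kernel :: "real^'n^'m \<Rightarrow> (real^'n) set"
  where "mat_kernel M = {v. M *v v = 0}"

(* The range of the submatrix formed by the columns indexed by I: all products
   of that submatrix with a coefficient vector; only y i for i in I matters. *)
definition column_range :: "real^'n^'m \<Rightarrow> 'n set \<Rightarrow> (real^'m) set"
  where "column_range A I = range (\<lambda>y::'n \<Rightarrow> real. \<Sum>i\<in>I. y i *\<^sub>R column i A)"

lemma column_range_empty: "column_range A {} = {0}"
  by (auto simp: column_range_def)

(* Meant for lam \<ge> 0. *)
definition solution_set ::
  "(real^'m \<Rightarrow> real) \<Rightarrow> real^'n^'m \<Rightarrow> real^'m \<Rightarrow> real \<Rightarrow> (real^'n) set"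
  where "solution_set h A b lam =
    {x. is_arg_min (\<lambda>x. h (A *v x - b) + lam * l1_norm x) (\<lambda>_. True) x}"

definition image_map ::
  "(real^'m \<Rightarrow> real) \<Rightarrow> real^'n^'m \<Rightarrow> real^'m \<Rightarrow> real \<Rightarrow> (real^'m) set"
  where "image_map h A b lam = {A *v x | x. x \<in> solution_set h A b lam}"

(* F is set-valued with domain D; on some neighbourhood of p inside D all its values
   are singletons and the resulting point-valued map is Lipschitz. *)
definition single_valued_lipschitz_near ::
  "'a::metric_space set \<Rightarrow> ('a \<Rightarrow> 'b::metric_space set) \<Rightarrow> 'a \<Rightarrow> bool"
  where "single_valued_lipschitz_near D F p \<longleftrightarrow>
    (\<exists>U L. open U \<and> p \<in> U \<and> U \<subseteq> D \<and>
      (\<forall>q\<in>U. is_singleton (F q)) \<and>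
      L-lipschitz_on U (\<lambda>q. the_elem (F q)))"

end

theory Submission
  imports Defs
begin

text \<open>
  Write \<open>G\<close> for the gradient of \<open>h\<close>, \<open>L\<close> for its Hessian at \<open>z0 = A x0 - b0\<close>, and \<open>J\<close> for the
  set of indices \<open>i\<close> with \<open>\<bar>A\<^sub>i \<bullet> G z0\<bar> = lam0\<close>. The proof compares two solutions \<open>x\<close> and \<open>x'\<close>
  for two nearby parameters \<open>(b, lam)\<close> and \<open>(b', lam')\<close>, with residuals \<open>z = A x - b\<close> and
  \<open>z' = A x' - b'\<close> close to \<open>z0\<close>, and bounds \<open>w = A x - A x'\<close> (\<open>solution_image_local_estimate\<close>).

  Optimality of \<open>x\<close> says that \<open>- A\<^sup>T G z / lam\<close> is a subgradient of the l1 norm at \<open>x\<close>. Subgradients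
  are monotone, so \<open>w \<bullet> (G z / lam - G z' / lam') \<le> 0\<close>, and therefore \<open>w \<bullet> (G z - G z')\<close> is at
  most a constant times \<open>\<bar>lam - lam'\<bar> norm w\<close>. Dividing by \<open>lam\<close> before comparing is what
  removes the difference of the l1 norms of \<open>x\<close> and \<open>x'\<close>, which \<open>w\<close> alone does not control
  directly. On the other side, \<open>G z - G z'\<close> is \<open>L (z - z')\<close> up to a small multiple of
  \<open>norm (z - z')\<close>, and \<open>z - z' = w - (b - b')\<close>. A lower bound \<open>c (norm w)\<^sup>2 \<le> w \<bullet> L w\<close> then gives
  \<open>norm w \<le> K (norm (b - b') + \<bar>lam - lam'\<bar>)\<close>.

  The lower bound holds for two reasons. A coordinate \<open>i\<close> outside \<open>J\<close> satisfies
  \<open>\<bar>A\<^sub>i \<bullet> G z\<bar> < lam\<close> near the reference point, which forces \<open>x\<^sub>i = 0\<close>; thus \<open>w\<close> lies in the range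
  of \<open>A\<^sub>J\<close>. Convexity of \<open>h\<close> makes the form \<open>v \<bullet> L v\<close> nonnegative, and \<open>L\<close> is symmetric, so the form
  vanishes only on the kernel of \<open>L\<close>, which meets that range only in \<open>0\<close>; compactness of the
  unit sphere supplies \<open>c\<close>.

  It remains to see that all solutions for nearby parameters have images near \<open>A x0\<close>. At the
  reference parameter, a solution far from \<open>x0\<close> can be moved along the segment towards \<open>x0\<close>
  until the local estimate applies, which shows that its image is \<open>A x0\<close>. Since solutions for
  nearby parameters are bounded and the solution map has closed graph, the images then
  converge to this unique value (\<open>solution_image_upper_semicontinuous\<close>).
\<close>
section \<open>Strict differentiability and the Hessian of a convex function\<close>

text \<open>
  Both increments range over a full neighbourhood of \<open>z\<close>. This is the form of differentiability
  that compares gradients at two arbitrary residuals, neither of which is \<open>z\<close>.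
\<close>
definition has_strict_derivative ::
  "('a::real_normed_vector \<Rightarrow> 'b::real_normed_vector) \<Rightarrow> ('a \<Rightarrow> 'b) \<Rightarrow> 'a \<Rightarrow> bool"
  where "has_strict_derivative G L z \<longleftrightarrow> bounded_linear L \<and>
    (\<forall>e>0. \<exists>r>0. \<forall>x\<in>ball z r. \<forall>y\<in>ball z r. norm (G x - G y - L (x - y)) \<le> e * norm (x - y))"

text \<open>
  On a small ball the Jacobian differs little from its value at the centre, so the mean value
  inequality applies to the function minus its linearisation at the centre.
\<close>
lemma continuous_jacobian_imp_strict_derivative:
  fixes G :: "real^'n \<Rightarrow> real^'m"
  assumes "open U" "z \<in> U"
    and diff: "\<And>y. y \<in> U \<Longrightarrow> G differentiable (at y)"
    and cont: "continuous_on U (\<lambda>y. jacobian G (at y))"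
  shows "has_strict_derivative G ((*v) (jacobian G (at z))) z"
  unfolding has_strict_derivative_def
proof (intro conjI allI impI)
  show "bounded_linear ((*v) (jacobian G (at z)))" by simp
next
  fix e :: real assume "e > 0"
  define J where "J y = jacobian G (at y)" for y
  \<comment> \<open>An entrywise error \<open>e'\<close> costs at most a factor \<open>CARD('m) * CARD('n)\<close> in operator norm.\<close>
  define e' where "e' = e / (real CARD('m) * real CARD('n))"
  have e': "e' > 0" using \<open>e > 0\<close> by (simp add: e'_def)
  have "isCont J z"
    using cont assms(1,2) by (simp add: continuous_on_eq_continuous_at J_def [abs_def])
  then obtain r1 where r1: "r1 > 0" "\<And>y. dist y z < r1 \<Longrightarrow> dist (J y) (J z) < e'"
    using e' unfolding continuous_at_eps_delta by blast
  obtain r2 where r2: "r2 > 0" "ball z r2 \<subseteq> U"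
    using assms(1,2) open_contains_ball by blast
  define r where "r = min r1 r2"
  have r: "r > 0" "ball z r \<subseteq> U" using r1 r2 by (auto simp: r_def)
  have on: "onorm (\<lambda>v. J y *v v - J z *v v) \<le> e" if "y \<in> ball z r" for y
  proof -
    have "onorm ((*v) (J y - J z)) \<le> real CARD('m) * real CARD('n) * e'"
    proof (rule onorm_le_matrix_component)
      fix i j
      have "\<bar>(J y - J z) $ i $ j\<bar> \<le> norm ((J y - J z) $ i)"
        by (rule component_le_norm_cart)
      also have "\<dots> \<le> norm (J y - J z)" by (rule Finite_Cartesian_Product.norm_nth_le)
      also have "\<dots> \<le> e'" using r1(2)[of y] that
        by (simp add: r_def dist_norm norm_minus_commute less_imp_le)
      finally show "\<bar>(J y - J z) $ i $ j\<bar> \<le> e'" .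
    qed
    also have "\<dots> = e" by (simp add: e'_def)
    moreover have "(*v) (J y - J z) = (\<lambda>v. J y *v v - J z *v v)"
      by (simp add: fun_eq_iff matrix_vector_mult_diff_rdistrib)
    ultimately show ?thesis by simp
  qed
  have "norm (G x - G y - J z *v (x - y)) \<le> e * norm (x - y)"
    if xy: "x \<in> ball z r" "y \<in> ball z r" for x y
  proof -
    have "norm (G x - G y - J z *v (x - y)) \<le> norm (x - y) * e"
    proof (rule differentiable_bound_linearization[where S = "ball z r" and f' = "\<lambda>u v. J u *v v"])
      fix t :: real assume "t \<in> {0..1}"
      then have "(1 - t) *\<^sub>R y + t *\<^sub>R x \<in> ball z r"
        using convexD_alt[OF convex_ball xy(2,1), of t] by simp
      then show "y + t *\<^sub>R (x - y) \<in> ball z r" by (simp add: algebra_simps)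
    next
      fix u assume "u \<in> ball z r"
      then show "(G has_derivative (*v) (J u)) (at u within ball z r)"
        using diff[of u] r(2) has_derivative_at_withinI unfolding jacobian_works J_def by blast
    qed (use r on in \<open>auto simp: fun_diff_def\<close>)
    then show ?thesis by (simp add: mult.commute)
  qed
  then show "\<exists>r>0. \<forall>x\<in>ball z r. \<forall>y\<in>ball z r.
      norm (G x - G y - jacobian G (at z) *v (x - y)) \<le> e * norm (x - y)"
    using r(1) unfolding J_def by blast
qed

lemma GDERIV_line:
  assumes "GDERIV f (x + t *\<^sub>R d) :> D"
  shows "((\<lambda>s. f (x + s *\<^sub>R d)) has_real_derivative d \<bullet> D) (at t)"
proof -
  have "((\<lambda>s. x + s *\<^sub>R d) has_derivative (\<lambda>s. s *\<^sub>R d)) (at t)"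
    by (auto intro!: derivative_eq_intros)
  from has_derivative_compose[OF this assms[unfolded gderiv_def]]
  show ?thesis by (simp add: has_field_derivative_def mult_commute_abs)
qed

text \<open>
  The second difference of \<open>f\<close> over the parallelogram spanned by \<open>t u\<close> and \<open>t v\<close> is the increment
  over \<open>[0, t]\<close> of \<open>s \<mapsto> f (z + t u + s v) - f (z + s v)\<close>, so the mean value theorem expresses
  it by a difference of gradients, which the strict derivative approximates. The second
  difference is symmetric in \<open>u\<close> and \<open>v\<close>, and this is the source of the symmetry of the Hessian.
\<close>
lemma second_difference_estimate:
  fixes f :: "'a::real_inner \<Rightarrow> real"
  assumes grad: "\<And>y. y \<in> ball z r \<Longrightarrow> GDERIV f y :> G y"
    and "linear L"
    and strict: "\<And>x y. \<lbrakk>x \<in> ball z r; y \<in> ball z r\<rbrakk> \<Longrightarrow> norm (G x - G y - L (x - y)) \<le> e * norm (x - y)"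
    and t: "0 < t" "t * (norm u + norm v) < r"
  shows "\<bar>f (z + t *\<^sub>R u + t *\<^sub>R v) - f (z + t *\<^sub>R u) - f (z + t *\<^sub>R v) + f z - t\<^sup>2 * (L u \<bullet> v)\<bar>
         \<le> e * t\<^sup>2 * norm u * norm v"
proof -
  define p where "p s = f (z + t *\<^sub>R u + s *\<^sub>R v) - f (z + s *\<^sub>R v)" for s
  have inb: "z + t *\<^sub>R u + s *\<^sub>R v \<in> ball z r" "z + s *\<^sub>R v \<in> ball z r" if "0 \<le> s" "s \<le> t" for s
  proof -
    have sv: "s * norm v \<le> t * norm v" using that by (intro mult_right_mono) auto
    have tri: "norm (t *\<^sub>R u + s *\<^sub>R v) \<le> t * norm u + s * norm v"
      using norm_triangle_ineq[of "t *\<^sub>R u" "s *\<^sub>R v"] that t(1) by simp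
    have tu: "0 \<le> t * norm u" using t(1) by simp
    have "norm (t *\<^sub>R u + s *\<^sub>R v) < r" "s * norm v < r"
      using t(2) sv tri tu unfolding distrib_left by linarith+
    then have "norm (t *\<^sub>R u + s *\<^sub>R v) < r" "norm (s *\<^sub>R v) < r"
      using that by simp_all
    moreover have "dist z (z + w) = norm w" for w by (simp add: dist_norm)
    ultimately show "z + t *\<^sub>R u + s *\<^sub>R v \<in> ball z r" "z + s *\<^sub>R v \<in> ball z r"
      unfolding mem_ball add.assoc by simp_all
  qed
  have der: "(p has_real_derivative (v \<bullet> G (z + t *\<^sub>R u + s *\<^sub>R v) - v \<bullet> G (z + s *\<^sub>R v))) (at s)"
    if "0 \<le> s" "s \<le> t" for s
    unfolding p_def
    by (rule DERIV_diff[OF GDERIV_line[OF grad[OF inb(1)[OF that]]] GDERIV_line[OF grad[OF inb(2)[OF that]]]])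
  obtain s where s: "0 < s" "s < t"
      "p t - p 0 = (t - 0) * (v \<bullet> G (z + t *\<^sub>R u + s *\<^sub>R v) - v \<bullet> G (z + s *\<^sub>R v))"
    using MVT2[OF t(1) der] by blast
  let ?x = "z + t *\<^sub>R u + s *\<^sub>R v" and ?y = "z + s *\<^sub>R v"
  have "norm (G ?x - G ?y - L (?x - ?y)) \<le> e * norm (?x - ?y)"
    using inb[of s] s by (intro strict) auto
  moreover have "?x - ?y = t *\<^sub>R u" by simp
  ultimately have est: "norm (G ?x - G ?y - t *\<^sub>R L u) \<le> e * (t * norm u)"
    using t(1) \<open>linear L\<close> by (simp add: linear_cmul)
  have "p t - p 0 - t\<^sup>2 * (L u \<bullet> v) = t * (v \<bullet> (G ?x - G ?y - t *\<^sub>R L u))"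
    unfolding s(3) inner_commute[of "L u"]
    by (simp add: inner_diff_right power2_eq_square right_diff_distrib)
  then have "\<bar>p t - p 0 - t\<^sup>2 * (L u \<bullet> v)\<bar> = t * \<bar>v \<bullet> (G ?x - G ?y - t *\<^sub>R L u)\<bar>"
    using t(1) by (simp add: abs_mult)
  also have "\<dots> \<le> t * (norm v * (e * (t * norm u)))"
    using t(1) by (intro mult_left_mono order_trans[OF Cauchy_Schwarz_ineq2] est) auto
  finally show ?thesis
    by (simp add: p_def power2_eq_square algebra_simps)
qed

lemma strict_derivative_of_gradient_symmetric:
  fixes f :: "'a::real_inner \<Rightarrow> real"
  assumes "0 < r0" and grad: "\<And>y. y \<in> ball z r0 \<Longrightarrow> GDERIV f y :> G y"
    and strict: "has_strict_derivative G L z"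
  shows "L u \<bullet> v = L v \<bullet> u"
proof -
  have lin: "linear L"
    using strict by (auto simp: has_strict_derivative_def bounded_linear.linear)
  define N where "N = 2 * norm u * norm v"
  have bound: "\<bar>L u \<bullet> v - L v \<bullet> u\<bar> \<le> e * N" if "0 < e" for e
  proof -
    obtain r1 where r1: "r1 > 0"
      "\<And>x y. \<lbrakk>x \<in> ball z r1; y \<in> ball z r1\<rbrakk> \<Longrightarrow> norm (G x - G y - L (x - y)) \<le> e * norm (x - y)"
      using strict \<open>0 < e\<close> unfolding has_strict_derivative_def by meson
    define r where "r = min r0 r1"
    have r: "r > 0" "ball z r \<subseteq> ball z r0" "ball z r \<subseteq> ball z r1"
      using \<open>0 < r0\<close> r1 by (auto simp: r_def)
    note grad_r = grad[OF subsetD[OF r(2)]] and strict_r = r1(2)[OF subsetD[OF r(3)] subsetD[OF r(3)]]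
    \<comment> \<open>Any positive \<open>t\<close> keeping the parallelogram inside the ball of radius \<open>r\<close> would do.\<close>
    define t where "t = r / (norm u + norm v + 1)"
    have den: "0 < norm u + norm v + 1" by (simp add: add_nonneg_pos)
    have t: "0 < t" using r(1) den by (simp add: t_def)
    have "t * (norm u + norm v) < t * (norm u + norm v + 1)" using t by simp
    also have "\<dots> = r" using den by (simp add: t_def)
    finally have tr: "t * (norm u + norm v) < r" .
    define D where "D = f (z + t *\<^sub>R u + t *\<^sub>R v) - f (z + t *\<^sub>R u) - f (z + t *\<^sub>R v) + f z"
    have 1: "\<bar>D - t\<^sup>2 * (L u \<bullet> v)\<bar> \<le> e * t\<^sup>2 * norm u * norm v"
      unfolding D_def
      by (rule second_difference_estimate[OF grad_r lin strict_r t tr])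
    have "\<bar>f (z + t *\<^sub>R v + t *\<^sub>R u) - f (z + t *\<^sub>R v) - f (z + t *\<^sub>R u) + f z - t\<^sup>2 * (L v \<bullet> u)\<bar>
         \<le> e * t\<^sup>2 * norm v * norm u"
      by (rule second_difference_estimate[OF grad_r lin strict_r t tr[unfolded add.commute[of "norm u"]]])
    then have 2: "\<bar>D - t\<^sup>2 * (L v \<bullet> u)\<bar> \<le> e * t\<^sup>2 * norm u * norm v"
      by (simp add: D_def algebra_simps)
    have "t\<^sup>2 * \<bar>L u \<bullet> v - L v \<bullet> u\<bar> = \<bar>t\<^sup>2 * (L u \<bullet> v) - t\<^sup>2 * (L v \<bullet> u)\<bar>"
      by (simp add: abs_mult flip: right_diff_distrib)
    also have "\<dots> \<le> t\<^sup>2 * (e * N)"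
      using 1 2 by (simp add: N_def algebra_simps abs_le_iff)
    finally show ?thesis using t by simp
  qed
  have "\<bar>L u \<bullet> v - L v \<bullet> u\<bar> \<le> 0 + e" if "0 < e" for e
  proof -
    have N: "0 \<le> N" by (simp add: N_def)
    have "\<bar>L u \<bullet> v - L v \<bullet> u\<bar> \<le> e / (N + 1) * N"
      using that N by (intro bound) simp
    also have "\<dots> \<le> e" using that N by (simp add: field_simps)
    finally show ?thesis by simp
  qed
  then have "\<bar>L u \<bullet> v - L v \<bullet> u\<bar> \<le> 0" by (rule field_le_epsilon)
  then show ?thesis by simp
qed

text \<open>
  Passing to the limit in difference quotients: the common step behind the tangent inequality
  for convex functions and the first-order optimality condition for minimisers.
\<close>
lemma directional_derivative_ge:
  assumes "GDERIV f x :> D"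
    and ge: "\<And>t. \<lbrakk>0 < t; t \<le> 1\<rbrakk> \<Longrightarrow> t * c \<le> f (x + t *\<^sub>R d) - f x"
  shows "c \<le> d \<bullet> D"
proof -
  have "((\<lambda>t. f (x + t *\<^sub>R d)) has_real_derivative d \<bullet> D) (at 0)"
    using assms(1) by (intro GDERIV_line) simp
  then have "((\<lambda>t. (f (x + t *\<^sub>R d) - f x) / t) \<longlongrightarrow> d \<bullet> D) (at 0)"
    by (simp add: has_field_derivative_iff)
  then have "((\<lambda>t. (f (x + t *\<^sub>R d) - f x) / t) \<longlongrightarrow> d \<bullet> D) (at_right 0)"
    by (rule filterlim_mono) (auto simp: at_le)
  moreover have "\<forall>\<^sub>F t in at_right 0. c \<le> (f (x + t *\<^sub>R d) - f x) / t"
    using eventually_at_right_less[of "0::real"] eventually_at_right_real[OF zero_less_one]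
    by eventually_elim (use ge in \<open>auto simp: field_simps\<close>)
  ultimately show ?thesis
    by (rule tendsto_lowerbound) simp
qed

lemma convex_above_tangent:
  assumes "convex_on UNIV f" "GDERIV f x :> D"
  shows "f x + (y - x) \<bullet> D \<le> f y"
proof -
  have "GDERIV (\<lambda>x. - f x) x :> - D" using assms(2) by (rule GDERIV_minus)
  then have "- (f y - f x) \<le> (y - x) \<bullet> - D"
  proof (rule directional_derivative_ge)
    fix t :: real assume "0 < t" "t \<le> 1"
    then have "f ((1 - t) *\<^sub>R x + t *\<^sub>R y) \<le> (1 - t) * f x + t * f y"
      using convex_onD[OF assms(1)] by simp
    then show "t * - (f y - f x) \<le> - f (x + t *\<^sub>R (y - x)) - - f x"
      by (simp add: algebra_simps)
  qed
  then show ?thesis by simp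
qed

text \<open>
  Adding the tangent inequalities at \<open>z\<close> and at \<open>z + t v\<close> shows that the gradient is monotone;
  to second order in \<open>t\<close> this monotonicity is the claim.
\<close>
lemma strict_derivative_of_convex_gradient_nonneg:
  fixes f :: "'a::real_inner \<Rightarrow> real"
  assumes convex: "convex_on UNIV f"
    and "0 < r0" and grad: "\<And>y. y \<in> ball z r0 \<Longrightarrow> GDERIV f y :> G y"
    and strict: "has_strict_derivative G L z"
  shows "0 \<le> L v \<bullet> v"
proof -
  have lin: "linear L"
    using strict by (auto simp: has_strict_derivative_def bounded_linear.linear)
  have bound: "0 \<le> L v \<bullet> v + e * (norm v)\<^sup>2" if "0 < e" for e
  proof -
    obtain r1 where r1: "r1 > 0"
      "\<And>x y. \<lbrakk>x \<in> ball z r1; y \<in> ball z r1\<rbrakk> \<Longrightarrow> norm (G x - G y - L (x - y)) \<le> e * norm (x - y)"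
      using strict \<open>0 < e\<close> unfolding has_strict_derivative_def by meson
    define r where "r = min r0 r1"
    have r: "r > 0" using \<open>0 < r0\<close> r1 by (auto simp: r_def)
    define t where "t = r / (norm v + 1)"
    have den: "0 < norm v + 1" by (simp add: add_nonneg_pos)
    have t: "0 < t" using r(1) den by (simp add: t_def)
    have "t * norm v < t * (norm v + 1)" using t by simp
    also have "\<dots> = r" using den by (simp add: t_def)
    finally have tr: "t * norm v < r" .
    let ?y = "z + t *\<^sub>R v"
    have inb: "?y \<in> ball z r0" "?y \<in> ball z r1" "z \<in> ball z r0" "z \<in> ball z r1"
      using tr t r1 \<open>0 < r0\<close> by (auto simp: dist_norm r_def)
    have "f z + (?y - z) \<bullet> G z \<le> f ?y" "f ?y + (z - ?y) \<bullet> G ?y \<le> f z"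
      by (intro convex_above_tangent convex grad inb)+
    then have mono: "0 \<le> t * (v \<bullet> (G ?y - G z))"
      by (simp add: algebra_simps inner_diff_right)
    have "norm (G ?y - G z - L (?y - z)) \<le> e * norm (?y - z)"
      by (rule r1(2)) (rule inb)+
    then have est: "norm (G ?y - G z - t *\<^sub>R L v) \<le> e * (t * norm v)"
      using t lin by (simp add: linear_cmul)
    have "v \<bullet> (G ?y - G z - t *\<^sub>R L v) \<le> norm v * (e * (t * norm v))"
      by (intro order_trans[OF norm_cauchy_schwarz] mult_left_mono est) auto
    then have "v \<bullet> (G ?y - G z) \<le> t * (L v \<bullet> v + e * (norm v)\<^sup>2)"
      by (simp add: inner_diff_right algebra_simps power2_eq_square inner_commute)
    moreover have "0 \<le> v \<bullet> (G ?y - G z)" using mono t by (simp add: zero_le_mult_iff)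
    ultimately have "0 \<le> t * (L v \<bullet> v + e * (norm v)\<^sup>2)" by linarith
    then show ?thesis using t by (simp add: zero_le_mult_iff)
  qed
  show ?thesis
  proof (rule field_le_epsilon)
    fix e :: real assume "0 < e"
    have pos: "0 < (norm v)\<^sup>2 + 1" by (simp add: add_nonneg_pos)
    have "0 \<le> L v \<bullet> v + e / ((norm v)\<^sup>2 + 1) * (norm v)\<^sup>2"
      using \<open>0 < e\<close> pos by (intro bound) simp
    also have "e / ((norm v)\<^sup>2 + 1) * (norm v)\<^sup>2 \<le> e"
      using \<open>0 < e\<close> pos by (simp add: field_simps)
    finally show "0 \<le> L v \<bullet> v + e" by simp
  qed
qed

text \<open>
  If the form vanishes at \<open>v\<close>, then along \<open>v - t L v\<close> it is \<open>t\<^sup>2 (L (L v) \<bullet> L v) - 2 t (L v \<bullet> L v)\<close>,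
  which is negative for small \<open>t > 0\<close> unless \<open>L v = 0\<close>. Symmetry is essential: a rotation of the
  plane by a right angle has a vanishing form and a trivial kernel.
\<close>
lemma symmetric_nonneg_form_kernel:
  fixes L :: "'a::real_inner \<Rightarrow> 'a"
  assumes "linear L" and sym: "\<And>u v. L u \<bullet> v = L v \<bullet> u"
    and nonneg: "\<And>v. 0 \<le> L v \<bullet> v" and "L v \<bullet> v = 0"
  shows "L v = 0"
proof -
  define N where "N = L v \<bullet> L v"
  define q where "q = L (L v) \<bullet> L v"
  have q: "0 \<le> q" unfolding q_def by (rule nonneg)
  have N: "0 \<le> N" by (simp add: N_def)
  \<comment> \<open>Chosen so that \<open>t * q \<le> N\<close>: the linear term then dominates the quadratic one.\<close>
  define t where "t = N / (q + 1)"
  have "0 \<le> L (v - t *\<^sub>R L v) \<bullet> (v - t *\<^sub>R L v)" by (rule nonneg)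
  also have "\<dots> = t * (t * q - 2 * N)"
    using \<open>linear L\<close> \<open>L v \<bullet> v = 0\<close> sym[of v "L v"]
    by (simp add: linear_diff linear_cmul inner_diff_left inner_diff_right N_def q_def algebra_simps sym[of "L v" v])
  finally have le: "0 \<le> t * (t * q - 2 * N)" .
  have "N \<le> 0"
  proof (rule ccontr)
    assume "\<not> N \<le> 0"
    then have "0 < t" using q by (simp add: t_def)
    then have "2 * N \<le> t * q" using le by (simp add: zero_le_mult_iff)
    also have "t * q \<le> N" using q N by (simp add: t_def field_simps)
    finally show False using \<open>\<not> N \<le> 0\<close> by simp
  qed
  with N have "L v \<bullet> L v = 0" unfolding N_def by (rule antisym[rotated])
  then show ?thesis by simp
qed

lemma positive_form_coercive_on_subspace:
  fixes L :: "'a::euclidean_space \<Rightarrow> 'a"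
  assumes "linear L" "subspace S" and pos: "\<And>v. \<lbrakk>v \<in> S; v \<noteq> 0\<rbrakk> \<Longrightarrow> 0 < L v \<bullet> v"
  obtains c where "0 < c" "\<And>v. v \<in> S \<Longrightarrow> c * (norm v)\<^sup>2 \<le> L v \<bullet> v"
proof (cases "S \<inter> sphere 0 1 = {}")
  case True
  have "v = 0" if "v \<in> S" for v
  proof (rule ccontr)
    assume "v \<noteq> 0"
    then have "(1 / norm v) *\<^sub>R v \<in> S \<inter> sphere 0 1"
      using that \<open>subspace S\<close> by (simp add: subspace_scale)
    with True show False by blast
  qed
  then show thesis using that[of 1] linear_0[OF \<open>linear L\<close>] by fastforce
next
  case False
  have comp: "compact (S \<inter> sphere 0 1)"
    using \<open>subspace S\<close> by (intro closed_Int_compact closed_subspace) auto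
  have "continuous_on (S \<inter> sphere 0 1) (\<lambda>v. L v \<bullet> v)"
    using \<open>linear L\<close> by (intro continuous_intros linear_continuous_on) (simp add: linear_conv_bounded_linear)
  from continuous_attains_inf[OF comp False this]
  obtain w where w: "w \<in> S \<inter> sphere 0 1" "\<And>v. v \<in> S \<inter> sphere 0 1 \<Longrightarrow> L w \<bullet> w \<le> L v \<bullet> v"
    by blast
  show thesis
  proof
    show "0 < L w \<bullet> w" using w(1) by (intro pos) auto
    fix v assume "v \<in> S"
    show "L w \<bullet> w * (norm v)\<^sup>2 \<le> L v \<bullet> v"
    proof (cases "v = 0")
      case True
      then show ?thesis by simp
    next
      case False
      then have "(1 / norm v) *\<^sub>R v \<in> S \<inter> sphere 0 1"
        using \<open>v \<in> S\<close> \<open>subspace S\<close> by (simp add: subspace_scale)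
      from w(2)[OF this] have "L w \<bullet> w \<le> (L v \<bullet> v) / (norm v)\<^sup>2"
        using \<open>linear L\<close> by (simp add: linear_cmul power2_eq_square)
      then show ?thesis using False by (simp add: field_simps)
    qed
  qed
qed

section \<open>Optimality conditions\<close>

lemma l1_norm_convex:
  assumes "0 \<le> t" "t \<le> 1"
  shows "l1_norm ((1 - t) *\<^sub>R x + t *\<^sub>R y) \<le> (1 - t) * l1_norm x + t * l1_norm y"
proof -
  have "\<bar>(1 - t) * x $ i + t * y $ i\<bar> \<le> (1 - t) * \<bar>x $ i\<bar> + t * \<bar>y $ i\<bar>" for i
    using abs_triangle_ineq[of "(1 - t) * x $ i" "t * y $ i"] assms by (simp add: abs_mult)
  then show ?thesis
    unfolding l1_norm_def by (simp add: sum_distrib_left flip: sum.distrib) (rule sum_mono, simp)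
qed

text \<open>
  Moving a single coordinate of a solution is the perturbation that reveals both the bound on
  the correlations \<open>A\<^sub>i \<bullet> g\<close> and the support condition below.
\<close>
lemma l1_norm_add_axis:
  "l1_norm (x + s *\<^sub>R axis i 1) = l1_norm x + (\<bar>x $ i + s\<bar> - \<bar>x $ i\<bar>)"
proof -
  have "l1_norm (x + s *\<^sub>R axis i 1) - l1_norm x
      = (\<Sum>j\<in>UNIV. if j = i then \<bar>x $ i + s\<bar> - \<bar>x $ i\<bar> else 0)"
    unfolding l1_norm_def sum_subtractf[symmetric] by (intro sum.cong) (auto simp: axis_def)
  then show ?thesis by simp
qed

lemma continuous_l1_norm [continuous_intros]:
  "continuous_on S f \<Longrightarrow> continuous_on S (\<lambda>x. l1_norm (f x))"
  unfolding l1_norm_def by (intro continuous_intros)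

lemma l1_norm_nonneg: "0 \<le> l1_norm x"
  unfolding l1_norm_def by (simp add: sum_nonneg)

lemma norm_le_l1_norm: "norm x \<le> l1_norm x"
  unfolding l1_norm_def by (rule norm_le_l1_cart)

lemma solution_set_iff:
  "x \<in> solution_set h A b lam \<longleftrightarrow>
    (\<forall>y. h (A *v x - b) + lam * l1_norm x \<le> h (A *v y - b) + lam * l1_norm y)"
  by (simp add: solution_set_def is_arg_min_linorder)

text \<open>
  Only the smooth part is differentiated: along the segment from \<open>x\<close> to \<open>y\<close> the l1 norm is
  bounded by its chord. Equivalently, \<open>- A\<^sup>T g / lam\<close> is a subgradient of the l1 norm at \<open>x\<close>
  (for \<open>lam > 0\<close>).
\<close>
lemma solution_variational_inequality:
  assumes sol: "x \<in> solution_set h A b lam" and "0 \<le> lam"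
    and grad: "GDERIV h (A *v x - b) :> g"
  shows "lam * (l1_norm x - l1_norm y) \<le> (A *v y - A *v x) \<bullet> g"
  using grad
proof (rule directional_derivative_ge)
  fix t :: real assume t: "0 < t" "t \<le> 1"
  let ?y = "(1 - t) *\<^sub>R x + t *\<^sub>R y"
  have "h (A *v x - b) + lam * l1_norm x \<le> h (A *v ?y - b) + lam * l1_norm ?y"
    using sol by (simp add: solution_set_iff)
  moreover have "lam * l1_norm ?y \<le> lam * ((1 - t) * l1_norm x + t * l1_norm y)"
    using t \<open>0 \<le> lam\<close> by (intro mult_left_mono l1_norm_convex) auto
  moreover have "A *v ?y - b = A *v x - b + t *\<^sub>R (A *v y - A *v x)"
    by (simp add: matrix_vector_right_distrib matrix_vector_mult_scaleR algebra_simps)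
  ultimately show "t * (lam * (l1_norm x - l1_norm y))
      \<le> h (A *v x - b + t *\<^sub>R (A *v y - A *v x)) - h (A *v x - b)"
    by (simp add: algebra_simps)
qed

lemma solution_coordinate_inequality:
  assumes "x \<in> solution_set h A b lam" "0 \<le> lam" "GDERIV h (A *v x - b) :> g"
  shows "lam * (\<bar>x $ i\<bar> - \<bar>x $ i + s\<bar>) \<le> s * (column i A \<bullet> g)"
proof -
  have eq: "A *v (x + s *\<^sub>R axis i 1) - A *v x = s *\<^sub>R column i A"
    by (simp add: matrix_vector_right_distrib matrix_vector_mult_scaleR matrix_vector_mult_basis)
  show ?thesis
    using solution_variational_inequality[OF assms, of "x + s *\<^sub>R axis i 1"]
    unfolding eq l1_norm_add_axis by (simp add: algebra_simps)
qed

lemma solution_correlation_le: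
  assumes "x \<in> solution_set h A b lam" "0 \<le> lam" "GDERIV h (A *v x - b) :> g"
  shows "\<bar>column i A \<bullet> g\<bar> \<le> lam"
proof -
  have "\<bar>x $ i + 1\<bar> - \<bar>x $ i\<bar> \<le> 1" "\<bar>x $ i + -1\<bar> - \<bar>x $ i\<bar> \<le> 1" by auto
  then have "lam * (\<bar>x $ i + 1\<bar> - \<bar>x $ i\<bar>) \<le> lam * 1" "lam * (\<bar>x $ i + -1\<bar> - \<bar>x $ i\<bar>) \<le> lam * 1"
    using assms(2) by (intro mult_left_mono; simp)+
  then show ?thesis
    using solution_coordinate_inequality[OF assms, of i 1]
      solution_coordinate_inequality[OF assms, of i "-1"]
    by (simp add: algebra_simps abs_le_iff)
qed

text \<open>
  Setting coordinate \<open>i\<close> to zero saves \<open>lam * \<bar>x $ i\<bar>\<close> in the penalty and, to first order, costs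
  at most \<open>\<bar>x $ i\<bar> * \<bar>column i A \<bullet> g\<bar>\<close> in the smooth term.
\<close>
lemma solution_support:
  assumes "x \<in> solution_set h A b lam" "0 \<le> lam" "GDERIV h (A *v x - b) :> g"
    and "\<bar>column i A \<bullet> g\<bar> < lam"
  shows "x $ i = 0"
proof (rule ccontr)
  assume nz: "x $ i \<noteq> 0"
  have "lam * \<bar>x $ i\<bar> \<le> - (x $ i) * (column i A \<bullet> g)"
    using solution_coordinate_inequality[OF assms(1-3), of i "- (x $ i)"] by simp
  also have "\<dots> \<le> \<bar>x $ i\<bar> * \<bar>column i A \<bullet> g\<bar>"
    by (metis abs_ge_self abs_minus_cancel abs_mult)
  also have "\<dots> < \<bar>x $ i\<bar> * lam" using nz assms(4) by simp
  finally show False by (simp add: mult.commute)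
qed

lemma matrix_vector_in_column_range:
  fixes A :: "real^'n^'m"
  assumes "\<And>i. i \<notin> J \<Longrightarrow> x $ i = 0"
  shows "A *v x \<in> column_range A J"
proof -
  have "A *v x = (\<Sum>i\<in>UNIV. x $ i *\<^sub>R column i A)"
    by (simp add: matrix_mult_sum scalar_mult_eq_scaleR)
  also have "\<dots> = (\<Sum>i\<in>J. x $ i *\<^sub>R column i A)"
    using assms by (intro sum.mono_neutral_right) auto
  finally show ?thesis unfolding column_range_def by blast
qed

lemma subspace_column_range: "subspace (column_range A J)"
proof -
  have "column_range A J = range (\<lambda>x :: real^'b. \<Sum>i\<in>J. x $ i *\<^sub>R column i A)"
    unfolding column_range_def
  proof (intro equalityI subsetI; elim rangeE)
    fix v y assume "v = (\<Sum>i\<in>J. y i *\<^sub>R column i A)"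
    then have "v = (\<Sum>i\<in>J. (\<chi> i. y i) $ i *\<^sub>R column i A)" by simp
    then show "v \<in> range (\<lambda>x :: real^'b. \<Sum>i\<in>J. x $ i *\<^sub>R column i A)" by blast
  qed blast
  moreover have "linear (\<lambda>x :: real^'b. \<Sum>i\<in>J. x $ i *\<^sub>R column i A)"
    by (rule linearI) (simp_all add: scaleR_left_distrib sum.distrib scaleR_right.sum)
  ultimately show ?thesis by (simp add: linear_subspace_image subspace_UNIV)
qed

section \<open>The local estimate\<close>

text \<open>
  The heart of the argument. The images \<open>A x\<close> and \<open>A x'\<close> are assumed to be near \<open>A x0\<close>;
  the solutions themselves need not be close to \<open>x0\<close>. With equal parameters the estimate
  says that the images coincide, so it yields uniqueness as well as Lipschitz continuity.
\<close>
lemma solution_image_local_estimate: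
  fixes A :: "real^'n^'m"
  assumes "0 < lam0" and sol0: "x0 \<in> solution_set h A b0 lam0"
    and z0: "z0 = A *v x0 - b0"
    and "0 < r0" and grad: "\<And>y. y \<in> ball z0 r0 \<Longrightarrow> GDERIV h y :> G y"
    and cont: "isCont G z0"
    and strict: "has_strict_derivative G L z0"
    and J: "J = {i. \<bar>column i A \<bullet> G z0\<bar> = lam0}"
    and "0 < c" and coercive: "\<And>v. v \<in> column_range A J \<Longrightarrow> c * (norm v)\<^sup>2 \<le> L v \<bullet> v"
  obtains d K where "0 < d" "0 \<le> K"
    "\<And>b lam x b' lam' x'. \<lbrakk>x \<in> solution_set h A b lam; x' \<in> solution_set h A b' lam';
       norm (b - b0) < d; \<bar>lam - lam0\<bar> < d; norm (A *v x - A *v x0) < d;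
       norm (b' - b0) < d; \<bar>lam' - lam0\<bar> < d; norm (A *v x' - A *v x0) < d\<rbrakk>
      \<Longrightarrow> norm (A *v x - A *v x') \<le> K * (norm (b - b') + \<bar>lam - lam'\<bar>)"
proof -
  have bl: "bounded_linear L" using strict by (simp add: has_strict_derivative_def)
  then have lin: "linear L" by (rule bounded_linear.linear)
  \<comment> \<open>A linearisation error of \<open>c / 2\<close> leaves half of the coercivity constant.\<close>
  have "0 < c / 2" using \<open>0 < c\<close> by simp
  then obtain r1 where r1: "r1 > 0"
    "\<And>x y. \<lbrakk>x \<in> ball z0 r1; y \<in> ball z0 r1\<rbrakk> \<Longrightarrow> norm (G x - G y - L (x - y)) \<le> c / 2 * norm (x - y)"
    using strict unfolding has_strict_derivative_def by meson
  define M where "M = norm (G z0) + 1"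
  have M: "0 < M" by (simp add: M_def add_nonneg_pos)
  have fl: "filterlim fst (nhds z0) (nhds (z0, lam0))" "filterlim snd (nhds lam0) (nhds (z0, lam0))"
    using tendsto_fst[OF filterlim_ident, of "(z0, lam0)"] tendsto_snd[OF filterlim_ident, of "(z0, lam0)"]
    by simp_all
  have "filterlim G (nhds (G z0)) (nhds z0)"
    using cont unfolding isCont_def tendsto_at_iff_tendsto_nhds .
  note tG = filterlim_compose[OF this fl(1)] and tl = fl(2)
  have "\<forall>\<^sub>F p in nhds (z0, lam0). norm (G (fst p)) < M"
    by (rule order_tendstoD(2)[OF tendsto_norm[OF tG]]) (simp add: M_def)
  moreover have "\<forall>\<^sub>F p in nhds (z0, lam0). \<forall>i\<in>-J. \<bar>column i A \<bullet> G (fst p)\<bar> < snd p"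
  proof (rule eventually_ball_finite[rule_format])
    fix i assume "i \<in> - J"
    moreover have "\<bar>column i A \<bullet> G z0\<bar> \<le> lam0"
      using solution_correlation_le[OF sol0] \<open>0 < lam0\<close> grad[of z0] \<open>0 < r0\<close> z0 by simp
    ultimately have "0 < lam0 - \<bar>column i A \<bullet> G z0\<bar>" by (simp add: J)
    moreover have "((\<lambda>p. snd p - \<bar>column i A \<bullet> G (fst p)\<bar>) \<longlongrightarrow> lam0 - \<bar>column i A \<bullet> G z0\<bar>) (nhds (z0, lam0))"
      by (intro tendsto_intros tG tl)
    ultimately have "\<forall>\<^sub>F p in nhds (z0, lam0). 0 < snd p - \<bar>column i A \<bullet> G (fst p)\<bar>"
      by (rule order_tendstoD(1)[rotated])
    then show "\<forall>\<^sub>F p in nhds (z0, lam0). \<bar>column i A \<bullet> G (fst p)\<bar> < snd p" by simp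
  qed simp
  ultimately have "\<forall>\<^sub>F p in nhds (z0, lam0). norm (G (fst p)) < M \<and> (\<forall>i\<in>-J. \<bar>column i A \<bullet> G (fst p)\<bar> < snd p)"
    by (rule eventually_conj)
  then obtain s where s: "s > 0" "\<And>p. dist p (z0, lam0) < s \<Longrightarrow>
      norm (G (fst p)) < M \<and> (\<forall>i\<in>-J. \<bar>column i A \<bullet> G (fst p)\<bar> < snd p)"
    unfolding eventually_nhds_metric by blast
  \<comment> \<open>A residual is within \<open>2 * d\<close> of \<open>z0\<close>, and paired with \<open>lam\<close> it is within \<open>3 * d\<close>.\<close>
  define d where "d = Min {r0 / 2, r1 / 2, s / 3, lam0 / 2}"
  have d: "0 < d" "2 * d \<le> r0" "2 * d \<le> r1" "3 * d \<le> s" "2 * d \<le> lam0"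
    using \<open>0 < r0\<close> r1(1) s(1) \<open>0 < lam0\<close> by (auto simp: d_def min_def)
  define B where "B = onorm L"
  have B: "0 \<le> B" unfolding B_def by (rule onorm_pos_le[OF bl])
  define K where "K = 2 / c * (2 * M / lam0 + (c / 2 + B))"
  have "0 \<le> K" using M B \<open>0 < c\<close> \<open>0 < lam0\<close> by (simp add: K_def)
  have loc: "A *v x - b \<in> ball z0 r0 \<and> A *v x - b \<in> ball z0 r1 \<and> norm (G (A *v x - b)) < M
      \<and> lam0 / 2 \<le> lam \<and> 0 < lam \<and> (\<forall>i. i \<notin> J \<longrightarrow> x $ i = 0)"
    if sol: "x \<in> solution_set h A b lam"
      and near: "norm (b - b0) < d" "\<bar>lam - lam0\<bar> < d" "norm (A *v x - A *v x0) < d" for b lam x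
  proof -
    let ?z = "A *v x - b"
    have "?z - z0 = (A *v x - A *v x0) - (b - b0)" by (simp add: z0)
    then have "norm (?z - z0) \<le> norm (A *v x - A *v x0) + norm (b - b0)"
      by (metis norm_triangle_ineq4)
    then have zd: "norm (?z - z0) < 2 * d" using near by simp
    have balls: "?z \<in> ball z0 r0" "?z \<in> ball z0 r1"
      using zd d by (auto simp: dist_norm norm_minus_commute)
    have "dist (?z, lam) (z0, lam0) \<le> dist ?z z0 + dist lam lam0"
      by (simp add: dist_Pair_Pair sqrt_sum_squares_le_sum)
    then have "dist (?z, lam) (z0, lam0) < s"
      using zd near(2) d(4) by (simp add: dist_norm)
    note * = s(2)[OF this, simplified]
    have lam: "lam0 / 2 \<le> lam" "0 < lam" using near(2) d(5) \<open>0 < lam0\<close> by (auto simp: abs_less_iff)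
    have "x $ i = 0" if "i \<notin> J" for i
      using solution_support[OF sol, of "G ?z" i] lam grad[OF balls(1)] * that by simp
    then show ?thesis using balls * lam by blast
  qed
  show thesis
  proof (rule that[OF d(1) \<open>0 \<le> K\<close>])
    fix b lam x b' lam' x'
    assume sol: "x \<in> solution_set h A b lam" and sol': "x' \<in> solution_set h A b' lam'"
      and near: "norm (b - b0) < d" "\<bar>lam - lam0\<bar> < d" "norm (A *v x - A *v x0) < d"
      and near': "norm (b' - b0) < d" "\<bar>lam' - lam0\<bar> < d" "norm (A *v x' - A *v x0) < d"
    define z where "z = A *v x - b"
    define z' where "z' = A *v x' - b'"
    define w where "w = A *v x - A *v x'"
    define \<beta> where "\<beta> = norm (b - b')"
    define \<mu> where "\<mu> = \<bar>lam - lam'\<bar>"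
    note l = loc[OF sol near, folded z_def] and l' = loc[OF sol' near', folded z'_def]
    have "w = A *v (x - x')" by (simp add: w_def matrix_vector_mult_diff_distrib)
    moreover have "A *v (x - x') \<in> column_range A J"
      using l l' by (intro matrix_vector_in_column_range) simp
    ultimately have w: "c * (norm w)\<^sup>2 \<le> L w \<bullet> w" using coercive by simp
    \<comment> \<open>The two variational inequalities are scaled by \<open>lam'\<close> and \<open>lam\<close>, so that the l1 norms
      cancel in their sum.\<close>
    have "lam * (l1_norm x - l1_norm x') \<le> (A *v x' - A *v x) \<bullet> G z"
      using solution_variational_inequality[OF sol, of "G z" x'] l grad by (simp add: z_def)
    then have "lam' * (lam * (l1_norm x - l1_norm x')) \<le> lam' * (- (w \<bullet> G z))"
      using l' by (intro mult_left_mono) (auto simp: w_def inner_diff_left)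
    moreover have "lam' * (l1_norm x' - l1_norm x) \<le> (A *v x - A *v x') \<bullet> G z'"
      using solution_variational_inequality[OF sol', of "G z'" x] l' grad by (simp add: z'_def)
    then have "lam * (lam' * (l1_norm x' - l1_norm x)) \<le> lam * (w \<bullet> G z')"
      using l by (intro mult_left_mono) (auto simp: w_def)
    ultimately have "lam' * (w \<bullet> (G z - G z')) \<le> (lam - lam') * (w \<bullet> G z')"
      by (simp add: algebra_simps inner_diff_right)
    also have "\<dots> \<le> \<mu> * (norm w * M)"
    proof -
      have "\<bar>w \<bullet> G z'\<bar> \<le> norm w * M"
        using l' by (intro order_trans[OF Cauchy_Schwarz_ineq2] mult_left_mono) auto
      then have "\<bar>(lam - lam') * (w \<bullet> G z')\<bar> \<le> \<mu> * (norm w * M)"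
        by (simp add: abs_mult \<mu>_def mult_left_mono)
      then show ?thesis by simp
    qed
    finally have le: "lam' * (w \<bullet> (G z - G z')) \<le> \<mu> * (norm w * M)" .
    have mono: "w \<bullet> (G z - G z') \<le> norm w * (2 * M / lam0 * \<mu>)"
    proof -
      have "w \<bullet> (G z - G z') \<le> (\<mu> * (norm w * M)) / lam'"
        using le l' by (simp add: pos_le_divide_eq mult.commute)
      also have "\<dots> \<le> (\<mu> * (norm w * M)) / (lam0 / 2)"
        using l' \<open>0 < lam0\<close> M by (intro divide_left_mono) (auto simp: \<mu>_def)
      finally show ?thesis by (simp add: algebra_simps)
    qed
    \<comment> \<open>Linearisation of \<open>G\<close> turns the bound on \<open>w \<bullet> (G z - G z')\<close> into one on \<open>w \<bullet> L w\<close>.\<close>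
    have zz: "z - z' = w - (b - b')" by (simp add: z_def z'_def w_def)
    have "norm (z - z') \<le> norm w + \<beta>" unfolding zz \<beta>_def by (rule norm_triangle_ineq4)
    then have "norm (G z - G z' - L (z - z')) \<le> c / 2 * (norm w + \<beta>)"
      using \<open>0 < c\<close> l l' by (intro order_trans[OF r1(2)] mult_left_mono) auto
    then have "norm w * norm (G z - G z' - L (z - z')) \<le> norm w * (c / 2 * (norm w + \<beta>))"
      by (intro mult_left_mono) auto
    moreover have "- (w \<bullet> (G z - G z' - L (z - z'))) \<le> norm w * norm (G z - G z' - L (z - z'))"
      using Cauchy_Schwarz_ineq2[of w "G z - G z' - L (z - z')"] by linarith
    ultimately have e1: "w \<bullet> L (z - z') \<le> w \<bullet> (G z - G z') + norm w * (c / 2 * (norm w + \<beta>))"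
      by (simp add: inner_diff_right)
    have e2: "w \<bullet> L (b - b') \<le> norm w * (B * \<beta>)"
      unfolding B_def \<beta>_def
      by (intro order_trans[OF norm_cauchy_schwarz] mult_left_mono onorm bl) auto
    have "L w \<bullet> w = w \<bullet> L (z - z') + w \<bullet> L (b - b')"
      unfolding zz linear_diff[OF lin, of w] by (simp add: inner_diff_right inner_commute)
    also have "\<dots> \<le> norm w * (2 * M / lam0 * \<mu> + c / 2 * (norm w + \<beta>) + B * \<beta>)"
      using e1 e2 mono by (simp only: distrib_left)
    finally have "norm w * (c * norm w) \<le> norm w * (2 * M / lam0 * \<mu> + c / 2 * (norm w + \<beta>) + B * \<beta>)"
      using w by (simp add: power2_eq_square algebra_simps)
    then have "c * norm w \<le> 2 * M / lam0 * \<mu> + c / 2 * (norm w + \<beta>) + B * \<beta> \<or> w = 0"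
      by auto
    then have "c / 2 * norm w \<le> 2 * M / lam0 * \<mu> + (c / 2 + B) * \<beta>"
    proof
      assume "w = 0"
      then show ?thesis using M B \<open>0 < c\<close> \<open>0 < lam0\<close> by (simp add: \<mu>_def \<beta>_def)
    next
      assume "c * norm w \<le> 2 * M / lam0 * \<mu> + c / 2 * (norm w + \<beta>) + B * \<beta>"
      moreover have "c * norm w = 2 * (c / 2 * norm w)" by simp
      ultimately show ?thesis unfolding distrib_left distrib_right by linarith
    qed
    also have "\<dots> \<le> 2 * M / lam0 * (\<beta> + \<mu>) + (c / 2 + B) * (\<beta> + \<mu>)"
      using M B \<open>0 < c\<close> \<open>0 < lam0\<close> by (intro add_mono mult_left_mono) (auto simp: \<mu>_def \<beta>_def)
    also have "\<dots> = c / 2 * (K * (\<beta> + \<mu>))"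
      using \<open>0 < c\<close> by (simp add: K_def field_simps)
    finally show "norm (A *v x - A *v x') \<le> K * (norm (b - b') + \<bar>lam - lam'\<bar>)"
      using \<open>0 < c\<close> by (simp add: w_def \<mu>_def \<beta>_def)
  qed
qed

section \<open>Existence, convexity and stability of the solution set\<close>

text \<open>
  Comparison with the zero vector. This is where nonnegativity of \<open>h\<close> enters: together with a
  positive \<open>lam\<close> it bounds the solutions, locally uniformly in the parameters.
\<close>
lemma solution_l1_bound:
  fixes A :: "real^'n^'m"
  assumes "\<And>z. 0 \<le> h z" "x \<in> solution_set h A b lam"
  shows "lam * l1_norm x \<le> h (- b)"
proof -
  have "h (A *v x - b) + lam * l1_norm x \<le> h (A *v 0 - b) + lam * l1_norm (0 :: real^'n)"
    using assms(2) unfolding solution_set_iff by blast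
  moreover have "l1_norm (0 :: real^'n) = 0" by (simp add: l1_norm_def)
  ultimately show ?thesis using assms(1)[of "A *v x - b"] by simp
qed

lemma solution_exists:
  fixes A :: "real^'n^'m"
  assumes "\<And>z. 0 \<le> h z" "continuous_on UNIV h" "0 < lam"
  shows "solution_set h A b lam \<noteq> {}"
proof -
  define F where "F x = h (A *v x - b) + lam * l1_norm x" for x
  define R where "R = h (- b) / lam"
  have R: "0 \<le> R" using assms by (simp add: R_def)
  have "continuous_on (cball 0 R) F"
    unfolding F_def
    by (intro continuous_intros continuous_on_compose2[OF assms(2)]) auto
  moreover have "compact (cball 0 R :: (real^'n) set)" "cball 0 R \<noteq> ({} :: (real^'n) set)"
    using R by auto
  ultimately obtain x where x: "\<And>y. y \<in> cball 0 R \<Longrightarrow> F x \<le> F y"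
    using continuous_attains_inf by metis
  have F0: "F 0 = h (- b)" by (simp add: F_def l1_norm_def)
  have "F x \<le> F y" for y
  proof (cases "y \<in> cball 0 R")
    case False
    then have "R < l1_norm y" using norm_le_l1_norm[of y] by simp
    then have "h (- b) < lam * l1_norm y" using assms(3) by (simp add: R_def field_simps)
    also have "\<dots> \<le> F y" using assms(1) by (simp add: F_def)
    finally show ?thesis using x[of 0] R F0 by simp
  qed (rule x)
  then have "x \<in> solution_set h A b lam" by (simp add: solution_set_iff F_def)
  then show ?thesis by blast
qed

lemma solution_set_convex_combination:
  assumes "convex_on UNIV h" "0 \<le> lam"
    "x \<in> solution_set h A b lam" "y \<in> solution_set h A b lam" "0 \<le> t" "t \<le> 1"
  shows "(1 - t) *\<^sub>R x + t *\<^sub>R y \<in> solution_set h A b lam"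
  unfolding solution_set_iff
proof
  fix u
  let ?F = "\<lambda>x. h (A *v x - b) + lam * l1_norm x"
  let ?v = "(1 - t) *\<^sub>R x + t *\<^sub>R y"
  have "A *v ?v - b = (1 - t) *\<^sub>R (A *v x - b) + t *\<^sub>R (A *v y - b)"
    by (simp add: matrix_vector_right_distrib matrix_vector_mult_scaleR algebra_simps)
  then have "h (A *v ?v - b) \<le> (1 - t) * h (A *v x - b) + t * h (A *v y - b)"
    using convex_onD[OF assms(1,5,6)] by simp
  moreover have "lam * l1_norm ?v \<le> lam * ((1 - t) * l1_norm x + t * l1_norm y)"
    using assms by (intro mult_left_mono l1_norm_convex)
  ultimately have "?F ?v \<le> (1 - t) * ?F x + t * ?F y" by (simp add: algebra_simps)
  also have "\<dots> \<le> (1 - t) * ?F u + t * ?F u"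
  proof -
    have "?F x \<le> ?F u" "?F y \<le> ?F u" using assms(3,4) unfolding solution_set_iff by blast+
    then show ?thesis using assms(5,6) by (intro add_mono[of "(1 - t) * _"] mult_left_mono) simp_all
  qed
  also have "\<dots> = ?F u" by (simp add: algebra_simps)
  finally show "?F ?v \<le> ?F u" .
qed

lemma solution_set_closed_graph:
  fixes A :: "real^'n^'m"
  assumes cont: "continuous_on UNIV h"
    and sol: "\<And>k. X k \<in> solution_set h A (B k) (\<Lambda> k)"
    and lim: "X \<longlonglongrightarrow> x" "B \<longlonglongrightarrow> b" "\<Lambda> \<longlonglongrightarrow> lam"
  shows "x \<in> solution_set h A b lam"
  unfolding solution_set_iff
proof
  fix y
  have "continuous_on UNIV (l1_norm :: real^'n \<Rightarrow> real)" by (intro continuous_intros)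
  then have l1: "isCont (l1_norm :: real^'n \<Rightarrow> real) u" for u
    by (simp add: continuous_on_eq_continuous_at)
  have h: "isCont h u" for u using cont by (simp add: continuous_on_eq_continuous_at)
  have AX: "(\<lambda>k. A *v X k) \<longlonglongrightarrow> A *v x"
    by (rule bounded_linear.tendsto[OF matrix_vector_mul_bounded_linear lim(1)])
  have "(\<lambda>k. h (A *v X k - B k) + \<Lambda> k * l1_norm (X k)) \<longlonglongrightarrow> h (A *v x - b) + lam * l1_norm x"
    by (intro tendsto_intros isCont_tendsto_compose[OF h] isCont_tendsto_compose[OF l1] lim AX)
  moreover have "(\<lambda>k. h (A *v y - B k) + \<Lambda> k * l1_norm y) \<longlonglongrightarrow> h (A *v y - b) + lam * l1_norm y"
    by (intro tendsto_intros isCont_tendsto_compose[OF h] lim)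
  ultimately show "h (A *v x - b) + lam * l1_norm x \<le> h (A *v y - b) + lam * l1_norm y"
    using sol unfolding solution_set_iff by (intro LIMSEQ_le) auto
qed

text \<open>
  A sequence of solutions violating the claim, for parameters tending to \<open>(b0, lam0)\<close>, is
  bounded, and by the closed graph its cluster points solve the limiting problem; their
  images equal \<open>v0\<close>.
\<close>
lemma solution_image_upper_semicontinuous:
  fixes A :: "real^'n^'m"
  assumes nonneg: "\<And>z. 0 \<le> h z" and cont: "continuous_on UNIV h" and "0 < lam0"
    and unique: "\<And>x. x \<in> solution_set h A b0 lam0 \<Longrightarrow> A *v x = v0"
    and "0 < e"
  shows "\<exists>d>0. \<forall>b lam x. dist (b, lam) (b0, lam0) < d \<longrightarrow> x \<in> solution_set h A b lam
      \<longrightarrow> norm (A *v x - v0) < e"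
proof (rule ccontr)
  assume neg: "\<not> ?thesis"
  \<comment> \<open>Radii tending to zero that keep \<open>\<Lambda> k\<close> above \<open>lam0 / 2\<close> and \<open>B k\<close> in a compact ball.\<close>
  define \<delta> where "\<delta> k = min 1 (lam0 / 2) / real (Suc k)" for k
  have \<delta>pos: "0 < \<delta> k" for k using \<open>0 < lam0\<close> by (simp add: \<delta>_def)
  have "\<forall>k. \<exists>b lam x. dist (b, lam) (b0, lam0) < \<delta> k \<and> x \<in> solution_set h A b lam
    \<and> \<not> norm (A *v x - v0) < e"
    using neg \<delta>pos by blast
  then obtain B \<Lambda> X where BLX: "\<And>k. dist (B k, \<Lambda> k) (b0, lam0) < \<delta> k"
    "\<And>k. X k \<in> solution_set h A (B k) (\<Lambda> k)" "\<And>k. \<not> norm (A *v X k - v0) < e"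
    by metis
  have "\<delta> \<longlonglongrightarrow> 0"
    unfolding \<delta>_def using lim_const_over_n[of "min 1 (lam0 / 2)"]
    by (subst filterlim_sequentially_Suc[of "\<lambda>k. min 1 (lam0 / 2) / real k"]) simp
  then have "(\<lambda>k. dist (B k, \<Lambda> k) (b0, lam0)) \<longlonglongrightarrow> 0"
    by (rule tendsto_sandwich[OF _ _ tendsto_const, rotated 2])
      (auto intro!: always_eventually less_imp_le[OF BLX(1)])
  then have "(\<lambda>k. (B k, \<Lambda> k)) \<longlonglongrightarrow> (b0, lam0)" by (simp add: tendsto_dist_iff[symmetric])
  then have lim: "B \<longlonglongrightarrow> b0" "\<Lambda> \<longlonglongrightarrow> lam0"
    using tendsto_fst tendsto_snd by fastforce+
  have "compact ((\<lambda>b. h (- b)) ` cball b0 1)"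
    by (intro compact_continuous_image continuous_on_compose2[OF cont] continuous_intros) auto
  then have "bounded ((\<lambda>b. h (- b)) ` cball b0 1)" by (rule compact_imp_bounded)
  then obtain C where C: "\<And>b. b \<in> cball b0 1 \<Longrightarrow> norm (h (- b)) \<le> C"
    unfolding bounded_iff by blast
  have "norm (X k) \<le> C / (lam0 / 2)" for k
  proof -
    have "\<delta> k \<le> min 1 (lam0 / 2)"
      using \<open>0 < lam0\<close> unfolding \<delta>_def by (intro divide_le_eq[THEN iffD2]) auto
    moreover have "dist (B k) b0 < \<delta> k" "dist (\<Lambda> k) lam0 < \<delta> k"
      using BLX(1)[of k] dist_fst_le[of "(B k, \<Lambda> k)" "(b0, lam0)"]
        dist_snd_le[of "(B k, \<Lambda> k)" "(b0, lam0)"] by auto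
    ultimately have near: "B k \<in> cball b0 1" "lam0 / 2 \<le> \<Lambda> k"
      by (auto simp: dist_commute dist_real_def abs_less_iff)
    have "lam0 / 2 * norm (X k) \<le> \<Lambda> k * l1_norm (X k)"
      using near(2) \<open>0 < lam0\<close> norm_le_l1_norm by (intro mult_mono) auto
    also have "\<dots> \<le> h (- B k)" by (rule solution_l1_bound[OF nonneg BLX(2)])
    also have "\<dots> \<le> C" using C[OF near(1)] by simp
    finally show ?thesis using \<open>0 < lam0\<close> by (simp add: field_simps)
  qed
  then have "bounded (range X)" by (intro boundedI) auto
  then obtain x \<rho> where \<rho>: "strict_mono (\<rho> :: nat \<Rightarrow> nat)" "(X \<circ> \<rho>) \<longlonglongrightarrow> x"
    using bounded_imp_convergent_subsequence by blast
  have "x \<in> solution_set h A b0 lam0"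
    by (rule solution_set_closed_graph[OF cont, of "X \<circ> \<rho>" A "B \<circ> \<rho>" "\<Lambda> \<circ> \<rho>"])
      (use \<rho> lim BLX(2) LIMSEQ_subseq_LIMSEQ in auto)
  then have "A *v x = v0" by (rule unique)
  moreover have "(\<lambda>k. A *v (X \<circ> \<rho>) k) \<longlonglongrightarrow> A *v x"
    by (rule bounded_linear.tendsto[OF matrix_vector_mul_bounded_linear \<rho>(2)])
  ultimately have "(\<lambda>k. norm (A *v (X \<circ> \<rho>) k - v0)) \<longlonglongrightarrow> 0"
    by (simp add: tendsto_norm_zero LIM_zero)
  then have "\<forall>\<^sub>F k in sequentially. norm (A *v (X \<circ> \<rho>) k - v0) < e"
    using \<open>0 < e\<close> by (rule order_tendstoD)
  then show False using BLX(3) by (auto simp: eventually_sequentially)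
qed

section \<open>Single-valuedness and Lipschitz continuity\<close>

theorem theorem3p1:
  fixes A :: "real^'n^'m"
    and h :: "real^'m \<Rightarrow> real"
    and b0 :: "real^'m"
    and lam0 :: real
    and x0 :: "real^'n"
  assumes h_nonneg: "\<And>z. 0 \<le> h z"
    and h_continuous: "continuous_on UNIV h"
    and h_convex: "convex_on UNIV h"
    and lam0_pos: "0 < lam0"
    and x0_solution: "x0 \<in> solution_set h A b0 lam0"
    and h_C2: "twice_continuously_differentiable_around h (A *v x0 - b0)"
    and kernel_condition:
      "mat_kernel (hessian h (A *v x0 - b0)) \<inter>
       column_range A {i. \<bar>column i A \<bullet> gradient h (A *v x0 - b0)\<bar> = lam0} = {0}"
  shows "single_valued_lipschitz_near (UNIV \<times> {0..})
           (\<lambda>(b, lam). image_map h A b lam) (b0, lam0)"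
proof -
  define z0 where "z0 = A *v x0 - b0"
  define G where "G = gradient h"
  define L where "L = (*v) (hessian h z0)"
  define J where "J = {i. \<bar>column i A \<bullet> G z0\<bar> = lam0}"
  obtain U where U: "open U" "z0 \<in> U" "\<And>y. y \<in> U \<Longrightarrow> h differentiable (at y)"
    "\<And>y. y \<in> U \<Longrightarrow> G differentiable (at y)" "continuous_on U (hessian h)"
    using h_C2 unfolding twice_continuously_differentiable_around_def z0_def G_def by blast
  obtain r0 where r0: "0 < r0" "ball z0 r0 \<subseteq> U"
    using U(1,2) open_contains_ball by blast
  have grad: "GDERIV h y :> G y" if "y \<in> ball z0 r0" for y
    unfolding G_def using that r0 U(3) by (intro GDERIV_gradient) auto
  have cont: "isCont G z0" using U(2,4) by (simp add: differentiable_imp_continuous_within)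
  have strict: "has_strict_derivative G L z0"
    unfolding L_def hessian_def G_def
    by (rule continuous_jacobian_imp_strict_derivative)
      (use U in \<open>auto simp: G_def hessian_def [abs_def]\<close>)
  have lin: "linear L" by (simp add: L_def)
  have sym: "L u \<bullet> v = L v \<bullet> u" for u v
    by (rule strict_derivative_of_gradient_symmetric[OF r0(1) grad strict])
  have nonneg: "0 \<le> L v \<bullet> v" for v
    by (rule strict_derivative_of_convex_gradient_nonneg[OF h_convex r0(1) grad strict])
  have "0 < L v \<bullet> v" if v: "v \<in> column_range A J" "v \<noteq> 0" for v
  proof (rule ccontr)
    assume "\<not> 0 < L v \<bullet> v"
    then have "L v \<bullet> v = 0" using nonneg[of v] by simp
    then have "L v = 0" by (rule symmetric_nonneg_form_kernel[OF lin sym nonneg])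
    then have "v \<in> mat_kernel (hessian h z0)" by (simp add: mat_kernel_def L_def)
    then show False using v kernel_condition by (auto simp: J_def z0_def G_def)
  qed
  then obtain c where c: "0 < c" "\<And>v. v \<in> column_range A J \<Longrightarrow> c * (norm v)\<^sup>2 \<le> L v \<bullet> v"
    using positive_form_coercive_on_subspace[OF lin subspace_column_range] by metis
  obtain d K where d: "0 < d" and K: "0 \<le> K" and est:
    "\<And>b lam x b' lam' x'. \<lbrakk>x \<in> solution_set h A b lam; x' \<in> solution_set h A b' lam';
       norm (b - b0) < d; \<bar>lam - lam0\<bar> < d; norm (A *v x - A *v x0) < d;
       norm (b' - b0) < d; \<bar>lam' - lam0\<bar> < d; norm (A *v x' - A *v x0) < d\<rbrakk>
      \<Longrightarrow> norm (A *v x - A *v x') \<le> K * (norm (b - b') + \<bar>lam - lam'\<bar>)"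
    using solution_image_local_estimate[OF lam0_pos x0_solution z0_def r0(1) grad cont strict J_def c]
    by metis

  have unique: "A *v x = A *v x0" if "x \<in> solution_set h A b0 lam0" for x
  proof -
    define N where "N = norm (A *v x - A *v x0)"
    \<comment> \<open>The solution set is convex, so \<open>x\<close> may be replaced by a point of the segment from \<open>x0\<close>
      to \<open>x\<close> whose image is within \<open>d\<close> of \<open>A x0\<close>; equal images there force equal images at \<open>x\<close>.\<close>
    define t where "t = min 1 (d / (N + 1))"
    have N: "0 \<le> N" by (simp add: N_def)
    have t: "0 < t" "t \<le> 1" using d N by (auto simp: t_def)
    have "t * N \<le> d / (N + 1) * N" using N by (intro mult_right_mono) (auto simp: t_def)
    also have "\<dots> < d" using d N by (simp add: field_simps)
    finally have tN: "t * N < d" .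
    let ?x = "(1 - t) *\<^sub>R x0 + t *\<^sub>R x"
    have eq: "A *v ?x - A *v x0 = t *\<^sub>R (A *v x - A *v x0)"
      by (simp add: matrix_vector_right_distrib matrix_vector_mult_scaleR algebra_simps)
    have "?x \<in> solution_set h A b0 lam0"
      using solution_set_convex_combination[OF h_convex _ x0_solution that, of t] lam0_pos t by simp
    moreover have "norm (A *v ?x - A *v x0) < d"
      unfolding eq using tN t by (simp add: N_def)
    ultimately have "norm (A *v ?x - A *v x0) \<le> K * (norm (b0 - b0) + \<bar>lam0 - lam0\<bar>)"
      using d by (intro est x0_solution) auto
    then have "t * norm (A *v x - A *v x0) \<le> 0" unfolding eq using t by simp
    then show ?thesis using t by (simp add: mult_le_0_iff)
  qed
  obtain d1 where d1: "0 < d1"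
    "\<And>b lam x. \<lbrakk>dist (b, lam) (b0, lam0) < d1; x \<in> solution_set h A b lam\<rbrakk>
      \<Longrightarrow> norm (A *v x - A *v x0) < d"
    using solution_image_upper_semicontinuous[OF h_nonneg h_continuous lam0_pos unique d] by blast
  \<comment> \<open>A radius of at most \<open>lam0\<close> keeps \<open>lam\<close> positive on the ball, which existence requires.\<close>
  define \<delta> where "\<delta> = Min {d, d1, lam0}"
  have \<delta>: "0 < \<delta>" "\<delta> \<le> d" "\<delta> \<le> d1" "\<delta> \<le> lam0"
    using d d1(1) lam0_pos by (auto simp: \<delta>_def)
  define W where "W = ball (b0, lam0) \<delta>"
  have near: "norm (b - b0) < d \<and> \<bar>lam - lam0\<bar> < d \<and> 0 < lam \<and>
      (\<forall>x \<in> solution_set h A b lam. norm (A *v x - A *v x0) < d)" if "(b, lam) \<in> W" for b lam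
  proof -
    have 1: "dist (b, lam) (b0, lam0) < \<delta>" using that by (simp add: W_def dist_commute)
    then have "dist b b0 < \<delta>" "dist lam lam0 < \<delta>"
      using dist_fst_le[of "(b, lam)" "(b0, lam0)"] dist_snd_le[of "(b, lam)" "(b0, lam0)"] by auto
    then show ?thesis using 1 \<delta> d1(2)[of b lam] by (auto simp: dist_norm abs_less_iff)
  qed
  have lip: "norm (A *v x - A *v x') \<le> K * (norm (b - b') + \<bar>lam - lam'\<bar>)"
    if "(b, lam) \<in> W" "(b', lam') \<in> W" "x \<in> solution_set h A b lam" "x' \<in> solution_set h A b' lam'"
    for b lam b' lam' x x'
    using near[OF that(1)] near[OF that(2)] that(3,4) by (intro est) auto
  have single: "image_map h A b lam = {A *v x}"
    if "(b, lam) \<in> W" "x \<in> solution_set h A b lam" for b lam x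
  proof -
    have "A *v y = A *v x" if "y \<in> solution_set h A b lam" for y
      using lip[OF \<open>(b, lam) \<in> W\<close> \<open>(b, lam) \<in> W\<close> that \<open>x \<in> solution_set h A b lam\<close>] by simp
    then show ?thesis using that(2) unfolding image_map_def by blast
  qed
  have ex: "\<exists>x. x \<in> solution_set h A b lam" if "(b, lam) \<in> W" for b lam
    using solution_exists[OF h_nonneg h_continuous, of lam A b] near[OF that] by blast
  show ?thesis
    unfolding single_valued_lipschitz_near_def
  proof (intro exI conjI)
    show "open W" "(b0, lam0) \<in> W" using \<delta> by (auto simp: W_def)
    show "W \<subseteq> UNIV \<times> {0..}" using near by force
    show "\<forall>q\<in>W. is_singleton (case q of (b, lam) \<Rightarrow> image_map h A b lam)"
      using ex single by (fastforce simp: is_singleton_def)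
    show "(2 * K)-lipschitz_on W (\<lambda>q. the_elem (case q of (b, lam) \<Rightarrow> image_map h A b lam))"
    proof (rule lipschitz_onI)
      fix q q' assume q: "q \<in> W" "q' \<in> W"
      obtain b lam b' lam' where qq: "q = (b, lam)" "q' = (b', lam')" by (cases q; cases q')
      obtain x x' where x: "x \<in> solution_set h A b lam" "x' \<in> solution_set h A b' lam'"
        using ex q qq by blast
      have "norm (A *v x - A *v x') \<le> K * (norm (b - b') + \<bar>lam - lam'\<bar>)"
        using lip q x unfolding qq by blast
      also have "\<dots> \<le> K * (2 * dist q q')"
        using K dist_fst_le[of q q'] dist_snd_le[of q q']
        by (intro mult_left_mono) (auto simp: qq dist_norm)
      finally show "dist (the_elem (case q of (b, lam) \<Rightarrow> image_map h A b lam))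
          (the_elem (case q' of (b, lam) \<Rightarrow> image_map h A b lam)) \<le> 2 * K * dist q q'"
        using single q x by (simp add: qq dist_norm mult_ac)
    qed (use K in simp)
  qed
qed

end
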